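(* Let $\mathsf{A}\in\mathbb{R}^{J_1\times J_1\times\cdots\times J_N\times J_N}$, $\mathsf{B}\in\mathbb{R}^{J_1\times K_1\times\cdots\times J_N\times K_N}$, $\mathsf{C}\in\mathbb{R}^{I_1\times J_1\times\cdots\times I_N\times J_N}$ have Kronecker ranks $R_1,R_2,R_3$ and generalized CPDs with component tensors $\mathsf{A}^{(n)}\in\mathbb{R}^{R_1\times J_n\times J_n}$, $\mathsf{B}^{(n)}\in\mathbb{R}^{R_2\times J_n\times K_n}$, $\mathsf{C}^{(n)}\in\mathbb{R}^{R_3\times I_n\times J_n}$, $n=1,\dots,N$, respectively. Then the multilinear time-invariant system $$\mathsf{X}_{t+1}=\mathsf{A}*\mathsf{X}_t+\mathsf{B}*\mathsf{U}_t,\qquad \mathsf{Y}_t=\mathsf{C}*\mathsf{X}_t$$ (with $\mathsf{X}_t\in\mathbb{R}^{J_1\times\cdots\times J_N}$, $\mathsf{U}_t\in\mathbb{R}^{K_1\times\cdots\times K_N}$, $\mathsf{Y}_t\in\mathbb{R}^{I_1\times\cdots\times I_N}$) is equivalent to the system $$\mathsf{X}_{t+1}=\sum_{r=1}^{R_1}\mathsf{X}_t\times\{\mathsf{A}_r^{(1)},\dots,\mathsf{A}_r^{(N)}\}+\sum_{r=1}^{R_2}\mathsf{U}_t\times\{\mathsf{B}_r^{(1)},\dots,\mathsf{B}_r^{(N)}\},\qquad \mathsf{Y}_t=\sum_{r=1}^{R_3}\mathsf{X}_t\times\{\mathsf{C}_r^{(1)},\dots,\mathsf{C}_r^{(N)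}\}.$$
   Context: The Einstein product of $\mathsf{M}\in\mathbb{R}^{P_1\times Q_1\times\cdots\times P_N\times Q_N}$ with $\mathsf{X}\in\mathbb{R}^{Q_1\times\cdots\times Q_N}$ is $(\mathsf{M}*\mathsf{X})_{p_1\cdots p_N}=\sum_{q_1,\dots,q_N}\mathsf{M}_{p_1q_1\cdots p_Nq_N}\mathsf{X}_{q_1\cdots q_N}$. The Tucker product of $\mathsf{X}\in\mathbb{R}^{Q_1\times\cdots\times Q_N}$ with matrices $\mathbf{M}_n\in\mathbb{R}^{P_n\times Q_n}$ is $(\mathsf{X}\times\{\mathbf{M}_1,\dots,\mathbf{M}_N\})_{p_1\cdots p_N}=\sum_{q_1,\dots,q_N}\mathsf{X}_{q_1\cdots q_N}(\mathbf{M}_1)_{p_1q_1}\cdots(\mathbf{M}_N)_{p_Nq_N}$. A generalized CPD of $\mathsf{M}\in\mathbb{R}^{P_1\times Q_1\times\cdots\times P_N\times Q_N}$ is an expression $\mathsf{M}=\sum_{r=1}^R\mathsf{M}_r^{(1)}\circ\cdots\circ\mathsf{M}_r^{(N)}$ with component tensors $\mathsf{M}^{(n)}\in\mathbb{R}^{R\times P_n\times Q_n}$, where $\mathsf{M}_r^{(n)}\in\mathbb{R}^{P_n\times Q_n}$ is the matrix slice with first index $r$ and $\circ$ is the outer product; i.e. $\mathsf{M}_{p_1q_1\cdots p_Nq_N}=\sum_{r=1}^R\mathsf{M}^{(1)}_{rp_1q_1}\cdots\mathsf{M}^{(N)}_{rp_Nq_N}$. The smallest such $R$ is the Kronecker rank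 of $\mathsf{M}$. "Equivalent" means that the two systems are satisfied by exactly the same sequences $(\mathsf{X}_t,\mathsf{U}_t,\mathsf{Y}_t)$. *)

theory Defs
  imports Complex_Main "HOL-Library.Function_Algebras"
begin

text \<open>
  The shape \<open>[d\<^sub>1, \<dots>, d\<^sub>k]\<close> of a tensor is a list of dimensions and a multi-index is a list of
  natural numbers. All indices are zero-based. A tensor is a function on multi-indices that
  vanishes off its index range, so equality of tensors is equality of functions, and addition and
  finite sums are the pointwise ones of \<open>HOL-Library.Function_Algebras\<close>.
\<close>

type_synonym tensor = "nat list \<Rightarrow> real"

definition multi_indices :: "nat list \<Rightarrow> nat list set" where
  "multi_indices ds = listset (map (\<lambda>d. {..<d}) ds)"

definition tensors :: "nat list \<Rightarrow> tensor set" where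
  "tensors ds = {X. \<forall>i. i \<notin> multi_indices ds \<longrightarrow> X i = 0}"

text \<open>
  The library function \<open>splice\<close> interleaves: for \<open>P = [P\<^sub>1, \<dots>, P\<^sub>N]\<close> and
  \<open>Q = [Q\<^sub>1, \<dots>, Q\<^sub>N]\<close>, the shape \<open>P\<^sub>1 \<times> Q\<^sub>1 \<times> \<cdots> \<times> P\<^sub>N \<times> Q\<^sub>N\<close> is \<open>splice P Q\<close>, and the
  multi-index \<open>p\<^sub>1 q\<^sub>1 \<cdots> p\<^sub>N q\<^sub>N\<close> is \<open>splice p q\<close>. An \<open>m \<times> n\<close> matrix is a tensor of
  shape \<open>[m, n]\<close>.
\<close>

definition einstein_product :: "nat list \<Rightarrow> nat list \<Rightarrow> tensor \<Rightarrow> tensor \<Rightarrow> tensor" where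
  "einstein_product P Q M X =
     (\<lambda>p. if p \<in> multi_indices P then \<Sum>q\<in>multi_indices Q. M (splice p q) * X q else 0)"

definition tucker_product :: "nat list \<Rightarrow> nat list \<Rightarrow> tensor \<Rightarrow> tensor list \<Rightarrow> tensor" where
  "tucker_product P Q X Ms =
     (\<lambda>p. if p \<in> multi_indices P
          then \<Sum>q\<in>multi_indices Q. X q * (\<Prod>n<length Ms. (Ms ! n) [p ! n, q ! n])
          else 0)"

text \<open>
  The outer product of the matrices \<open>M\<^sub>1, \<dots>, M\<^sub>N\<close>, a tensor of order \<open>2 * N\<close>: the \<open>n\<close>-th
  matrix (from \<open>0\<close>) reads positions \<open>2 * n\<close> and \<open>2 * n + 1\<close> of the multi-index.
\<close>

definition outer_product :: "tensor list \<Rightarrow> tensor" where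
  "outer_product Ms =
     (\<lambda>i. if length i = 2 * length Ms
          then \<Prod>n<length Ms. (Ms ! n) [i ! (2 * n), i ! (2 * n + 1)]
          else 0)"

definition slice :: "nat \<Rightarrow> tensor \<Rightarrow> tensor" where
  "slice r T = (\<lambda>i. T (r # i))"

definition generalized_CPD :: "nat list \<Rightarrow> nat list \<Rightarrow> nat \<Rightarrow> tensor list \<Rightarrow> tensor \<Rightarrow> bool" where
  "generalized_CPD P Q R Ts M \<longleftrightarrow>
     length Ts = length P \<and>
     (\<forall>n<length P. Ts ! n \<in> tensors [R, P ! n, Q ! n]) \<and>
     M = (\<Sum>r<R. outer_product (map (slice r) Ts))"

text \<open>
  The empty sum is admitted, so the zero tensor has Kronecker rank \<open>0\<close>.
\<close>

definition kronecker_rank :: "nat list \<Rightarrow> nat list \<Rightarrow> tensor \<Rightarrow> nat" where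
  "kronecker_rank P Q M = (LEAST R. \<exists>Ts. generalized_CPD P Q R Ts M)"

definition MLTI_system ::
  "nat list \<Rightarrow> nat list \<Rightarrow> nat list \<Rightarrow> tensor \<Rightarrow> tensor \<Rightarrow> tensor \<Rightarrow>
   (nat \<Rightarrow> tensor) \<Rightarrow> (nat \<Rightarrow> tensor) \<Rightarrow> (nat \<Rightarrow> tensor) \<Rightarrow> bool" where
  "MLTI_system I J K A B C X U Y \<longleftrightarrow>
     (\<forall>t. X t \<in> tensors J \<and> U t \<in> tensors K \<and> Y t \<in> tensors I) \<and>
     (\<forall>t. X (t + 1) = einstein_product J J A (X t) + einstein_product J K B (U t) \<and>
          Y t = einstein_product I J C (X t))"

definition CPD_system ::
  "nat list \<Rightarrow> nat list \<Rightarrow> nat list \<Rightarrow> nat \<Rightarrow> nat \<Rightarrow> nat \<Rightarrow>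
   tensor list \<Rightarrow> tensor list \<Rightarrow> tensor list \<Rightarrow>
   (nat \<Rightarrow> tensor) \<Rightarrow> (nat \<Rightarrow> tensor) \<Rightarrow> (nat \<Rightarrow> tensor) \<Rightarrow> bool" where
  "CPD_system I J K R\<^sub>1 R\<^sub>2 R\<^sub>3 As Bs Cs X U Y \<longleftrightarrow>
     (\<forall>t. X t \<in> tensors J \<and> U t \<in> tensors K \<and> Y t \<in> tensors I) \<and>
     (\<forall>t. X (t + 1) = (\<Sum>r<R\<^sub>1. tucker_product J J (X t) (map (slice r) As)) +
                      (\<Sum>r<R\<^sub>2. tucker_product J K (U t) (map (slice r) Bs)) \<and>
          Y t = (\<Sum>r<R\<^sub>3. tucker_product I J (X t) (map (slice r) Cs)))"

end

theory Submission
  imports Defs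
begin

text \<open>Substituting a generalized CPD of \<open>M\<close> into an entry of the Einstein product
  gives a double sum over \<open>q\<close> and \<open>r\<close>. Exchanging the two finite sums
  leaves, for each \<open>r\<close>, the Tucker product with the \<open>r\<close>-th slices. Thus
  the two operators agree on every \<open>X\<close>
  (\<open>einstein_product_generalized_CPD\<close>), and the systems coincide equation by equation.
  The index bookkeeping is in \<open>outer_product_splice\<close>.\<close>

lemma sum_fun_apply: "(\<Sum>a\<in>S. f a) x = (\<Sum>a\<in>S. f a x)"
  for f :: "'a \<Rightarrow> 'b \<Rightarrow> 'c::comm_monoid_add"
  by (induction S rule: infinite_finite_induct) auto

lemma length_multi_index:
  assumes "i \<in> multi_indices ds"
  shows "length i = length ds"
proof -
  have "length xs = length Ss" if "xs \<in> listset Ss" for xs :: "nat list" and Ss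
    using that by (induction Ss arbitrary: xs) (auto simp: set_Cons_def)
  then show ?thesis
    using assms by (auto simp: multi_indices_def)
qed

lemma splice_nth:
  assumes "length xs = length ys" "n < length xs"
  shows "splice xs ys ! (2 * n) = xs ! n" "splice xs ys ! Suc (2 * n) = ys ! n"
  using assms by (induction xs ys arbitrary: n rule: list_induct2) (auto simp: less_Suc_eq_0_disj)

text \<open>Interleaving puts \<open>p ! n\<close> and \<open>q ! n\<close> at exactly the two
  positions read by the \<open>n\<close>-th matrix. The length assumptions rule out the default
  value 0 of \<open>outer_product\<close>.\<close>

lemma outer_product_splice:
  assumes "length p = length Ms" "length q = length Ms"
  shows "outer_product Ms (splice p q) = (\<Prod>n<length Ms. (Ms ! n) [p ! n, q ! n])"
  using assms by (simp add: outer_product_def splice_nth)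

lemma einstein_product_generalized_CPD:
  assumes "length P = length Q" "generalized_CPD P Q R Ts M"
  shows "einstein_product P Q M X = (\<Sum>r<R. tucker_product P Q X (map (slice r) Ts))"
proof
  fix p
  have len: "length Ts = length P" and M: "M = (\<Sum>r<R. outer_product (map (slice r) Ts))"
    using assms(2) by (auto simp: generalized_CPD_def)
  show "einstein_product P Q M X p = (\<Sum>r<R. tucker_product P Q X (map (slice r) Ts)) p"
  proof (cases "p \<in> multi_indices P")
    case True
    \<comment> \<open>Membership in the index ranges fixes the lengths of \<open>p\<close> and
      \<open>q\<close>, as \<open>outer_product_splice\<close> requires.\<close>
    have "M (splice p q) = (\<Sum>r<R. \<Prod>n<length Ts. (map (slice r) Ts ! n) [p ! n, q ! n])"
      if "q \<in> multi_indices Q" for q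
      using length_multi_index[OF True] length_multi_index[OF that] len assms(1)
      by (simp add: M sum_fun_apply outer_product_splice)
    then have "einstein_product P Q M X p =
        (\<Sum>q\<in>multi_indices Q. \<Sum>r<R.
          X q * (\<Prod>n<length Ts. (map (slice r) Ts ! n) [p ! n, q ! n]))"
      using True by (simp add: einstein_product_def sum_distrib_left sum_distrib_right mult.commute)
    \<comment> \<open>With \<open>r\<close> outermost, each inner sum over \<open>q\<close> is an
      entry of a Tucker product.\<close>
    also have "\<dots> = (\<Sum>r<R. tucker_product P Q X (map (slice r) Ts)) p"
      using True by (subst sum.swap) (simp add: sum_fun_apply tucker_product_def)
    finally show ?thesis .
  \<comment> \<open>Off the index range both sides are 0 by definition.\<close>
  qed (simp add: einstein_product_def tucker_product_def sum_fun_apply)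
qed

theorem proposition6p4:
  fixes N R\<^sub>1 R\<^sub>2 R\<^sub>3 :: nat
    and I J K :: "nat list"
    and A B C :: tensor
    and As Bs Cs :: "tensor list"
  assumes "N \<ge> 1"
    and "length I = N" "length J = N" "length K = N"
    and "\<forall>n<N. I ! n \<ge> 1 \<and> J ! n \<ge> 1 \<and> K ! n \<ge> 1"
    and "A \<in> tensors (splice J J)"
    and "B \<in> tensors (splice J K)"
    and "C \<in> tensors (splice I J)"
    and "kronecker_rank J J A = R\<^sub>1"
    and "kronecker_rank J K B = R\<^sub>2"
    and "kronecker_rank I J C = R\<^sub>3"
    and "generalized_CPD J J R\<^sub>1 As A"
    and "generalized_CPD J K R\<^sub>2 Bs B"
    and "generalized_CPD I J R\<^sub>3 Cs C"
  shows "\<forall>X U Y. MLTI_system I J K A B C X U Y \<longleftrightarrow>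
                 CPD_system I J K R\<^sub>1 R\<^sub>2 R\<^sub>3 As Bs Cs X U Y"
  \<comment> \<open>Both systems impose the same shape conditions, so rewriting the three Einstein
    products turns one into the other.\<close>
  using assms by (simp add: MLTI_system_def CPD_system_def einstein_product_generalized_CPD)

end
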